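(* Let $D=\{(x,y)\in{}^2({}^\omega({}^\omega 2)) : (\exists n)(x(n)(0)\neq y(n)(0))\}$. Then $D$ is dense open in ${}^2({}^\omega({}^\omega 2))$, and for every $\Delta^1_1$ set $B\subseteq{}^\omega({}^\omega 2)$ such that $E_1\upharpoonright B\equiv_{\Delta^1_1}E_1$, we have $[B]^2_{E_1}\not\subseteq D$. Consequently $E_1$ does not have the $2$-Mycielski property.
   Context: ${}^\omega({}^\omega 2)$ carries the product topology. $E_1$ is the equivalence relation on ${}^\omega({}^\omega 2)$ given by $x\,E_1\,y$ iff there is $k$ such that $x(n)=y(n)$ for all $n\ge k$. For an equivalence relation $E$ on a set $X$ and $n\in\omega$, $[X]^n_E=\{(x_0,\dots,x_{n-1})\in{}^nX:(\forall i\neq j)\,\neg(x_i\,E\,x_j)\}$. For equivalence relations $E,F$ on Polish spaces $X,Y$, $E\le_{\Delta^1_1}F$ means there is a $\Delta^1_1$ (Borel) function $\Phi:X\to Y$ with $a\,E\,b\iff\Phi(a)\,F\,\Phi(b)$; $E\equiv_{\Delta^1_1}F$ means both directions hold. An equivalence relation $E$ on a Polish space $X$ has the $n$-Mycielski property iff for every comeager $C\subseteq{}^nX$ there is a $\Delta^1_1$ set $A\subseteq X$ with $E\equiv_{\Delta^1_1}E\upharpoonright A$ and $[A]^n_E\subseteq C$. *)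

theory Defs
  imports "HOL-Analysis.Analysis"
begin

text \<open>
  The Cantor space is represented by \<^typ>\<open>nat \<Rightarrow> bool\<close>, and its countable power by
  \<^typ>\<open>nat \<Rightarrow> nat \<Rightarrow> bool\<close>; the library topology on function types is the product topology.
  The library gives \<^typ>\<open>bool\<close> its discrete topology but no metric. Adding the discrete metric
  makes these spaces instances of \<^class>\<open>polish_space\<close>.
\<close>

instantiation bool :: metric_space
begin

definition dist_bool :: "bool \<Rightarrow> bool \<Rightarrow> real"
  where "dist_bool a b = (if a = b then 0 else 1)"

definition uniformity_bool :: "(bool \<times> bool) filter"
  where "uniformity_bool = (INF e\<in>{0<..}. principal {(x, y). dist x y < e})"

instance
proof
  show "(uniformity :: (bool \<times> bool) filter) = (INF e\<in>{0<..}. principal {(x, y). dist x y < e})"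
    by (rule uniformity_bool_def)
next
  fix U :: "bool set"
  have "eventually (\<lambda>(x', y). x' = x \<longrightarrow> y \<in> U) uniformity" if "x \<in> U" for x
  proof -
    have "principal {(x, y). dist x y < 1} \<ge> (uniformity :: (bool \<times> bool) filter)"
      unfolding uniformity_bool_def by (rule INF_lower) simp
    moreover have "eventually (\<lambda>(x', y). x' = x \<longrightarrow> y \<in> U) (principal {(x, y :: bool). dist x y < 1})"
      using that by (auto simp: eventually_principal dist_bool_def split: if_splits)
    ultimately show ?thesis
      by (rule filter_leD)
  qed
  then show "open U \<longleftrightarrow> (\<forall>x\<in>U. eventually (\<lambda>(x', y). x' = x \<longrightarrow> y \<in> U) uniformity)"
    by (simp add: open_discrete)
next
  fix x y z :: bool
  show "dist x y = 0 \<longleftrightarrow> x = y"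
    by (simp add: dist_bool_def)
  show "dist x y \<le> dist x z + dist y z"
    by (simp add: dist_bool_def)
qed

end

instance bool :: complete_space
proof
  fix X :: "nat \<Rightarrow> bool"
  assume "Cauchy X"
  then obtain M where M: "\<forall>m\<ge>M. \<forall>n\<ge>M. dist (X m) (X n) < 1"
    unfolding Cauchy_def by (metis zero_less_one)
  then have "\<forall>n\<ge>M. X n = X M"
    by (auto simp: dist_bool_def split: if_splits)
  then have "eventually (\<lambda>n. X n = X M) sequentially"
    unfolding eventually_sequentially by blast
  then have "X \<longlonglongrightarrow> X M"
    by (rule tendsto_eventually)
  then show "convergent X"
    by (rule convergentI)
qed

instance bool :: second_countable_topology
proof
  have "open = generate_topology (UNIV :: bool set set)"
    by (auto simp: fun_eq_iff open_discrete intro: generate_topology.Basis)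
  then show "\<exists>B :: bool set set. countable B \<and> open = generate_topology B"
    by (blast intro: countable_finite finite)
qed

instance bool :: polish_space ..


definition nowhere_dense_in :: "'a topology \<Rightarrow> 'a set \<Rightarrow> bool"
  where "nowhere_dense_in T N \<longleftrightarrow> N \<subseteq> topspace T \<and> T interior_of (T closure_of N) = {}"

definition meager_in :: "'a topology \<Rightarrow> 'a set \<Rightarrow> bool"
  where "meager_in T M \<longleftrightarrow> (\<exists>\<N>. countable \<N> \<and> (\<forall>N\<in>\<N>. nowhere_dense_in T N) \<and> M = \<Union>\<N>)"

definition comeager_in :: "'a topology \<Rightarrow> 'a set \<Rightarrow> bool"
  where "comeager_in T C \<longleftrightarrow> C \<subseteq> topspace T \<and> meager_in T (topspace T - C)"

text \<open>
  A relation is given together with its domain, so that the restriction of \<open>E\<close> to a Borel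
  set \<open>A\<close> is the pair \<open>A\<close>, \<open>Restr E A\<close>; Borel maps on \<open>A\<close> are taken with respect to the
  trace of the Borel sets on \<open>A\<close>.
\<close>

definition borel_reducible ::
  "'a::polish_space set \<Rightarrow> ('a \<times> 'a) set \<Rightarrow> 'b::polish_space set \<Rightarrow> ('b \<times> 'b) set \<Rightarrow> bool"
  where "borel_reducible X E Y F \<longleftrightarrow>
    (\<exists>\<Phi> \<in> restrict_space borel X \<rightarrow>\<^sub>M restrict_space borel Y.
      \<forall>a\<in>X. \<forall>b\<in>X. (a, b) \<in> E \<longleftrightarrow> (\<Phi> a, \<Phi> b) \<in> F)"

definition borel_bireducible ::
  "'a::polish_space set \<Rightarrow> ('a \<times> 'a) set \<Rightarrow> 'b::polish_space set \<Rightarrow> ('b \<times> 'b) set \<Rightarrow> bool"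
  where "borel_bireducible X E Y F \<longleftrightarrow> borel_reducible X E Y F \<and> borel_reducible Y F X E"

text \<open>The \<open>n\<close>-tuples are the extensional functions on \<open>{..<n}\<close>.\<close>

definition tuple_topology :: "nat \<Rightarrow> (nat \<Rightarrow> 'a::topological_space) topology"
  where "tuple_topology n = product_topology (\<lambda>_. euclidean) {..<n}"

definition inequivalent_tuples :: "nat \<Rightarrow> ('a \<times> 'a) set \<Rightarrow> 'a set \<Rightarrow> (nat \<Rightarrow> 'a) set"
  where "inequivalent_tuples n E X =
    {x \<in> {..<n} \<rightarrow>\<^sub>E X. \<forall>i<n. \<forall>j<n. i \<noteq> j \<longrightarrow> (x i, x j) \<notin> E}"

definition mycielski_property :: "nat \<Rightarrow> ('a::polish_space \<times> 'a) set \<Rightarrow> bool"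
  where "mycielski_property n E \<longleftrightarrow>
    (\<forall>C. comeager_in (tuple_topology n) C \<longrightarrow>
      (\<exists>A\<in>sets borel. borel_bireducible UNIV E A (Restr E A) \<and> inequivalent_tuples n E A \<subseteq> C))"

definition E1 :: "((nat \<Rightarrow> nat \<Rightarrow> bool) \<times> (nat \<Rightarrow> nat \<Rightarrow> bool)) set"
  where "E1 = {(x, y). \<exists>k. \<forall>n\<ge>k. x n = y n}"

lemma equiv_E1: "equiv UNIV E1"
proof (rule equivI)
  show "trans E1"
  proof (rule transI)
    fix x y z assume "(x, y) \<in> E1" "(y, z) \<in> E1"
    then obtain k l where "\<forall>n\<ge>k. x n = y n" "\<forall>n\<ge>l. y n = z n"
      by (auto simp: E1_def)
    then have "\<forall>n\<ge>max k l. x n = z n"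
      by simp
    then show "(x, z) \<in> E1"
      unfolding E1_def by blast
  qed
  show "sym E1"
    unfolding sym_def E1_def by (simp add: eq_commute)
qed (simp_all add: E1_def refl_on_def)

definition D :: "(nat \<Rightarrow> nat \<Rightarrow> nat \<Rightarrow> bool) set"
  where "D = {p \<in> {..<2} \<rightarrow>\<^sub>E UNIV. \<exists>n. p 0 n 0 \<noteq> p 1 n 0}"

end

theory Submission
  imports Defs "HOL-Probability.Infinite_Product_Measure"
begin

text \<open>
  Suppose that \<open>\<Phi>\<close> reduces \<open>E1\<close> to its restriction to \<open>B\<close> and that any two \<open>E1\<close>-inequivalent points
  of \<open>B\<close> differ in some first bit. Let \<open>f a\<close> be the sequence of first bits of \<open>\<Phi> a\<close>. Then
  \<open>f a = f b\<close> implies that \<open>a\<close> and \<open>b\<close> are \<open>E1\<close>-equivalent, whereas on an \<open>E1\<close>-class \<open>f\<close> takes only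
  countably many values, all being finite modifications of one sequence. Take an atomless Borel
  probability measure on the Cantor space, its countable power, and a closed set \<open>K\<close> of positive
  measure on which the fibres of \<open>f\<close> are closed. By Fubini and the countability of the values, from
  almost every point of \<open>K\<close> one can change any single coordinate and stay in \<open>K\<close> without changing
  \<open>f\<close>. Changing the coordinates \<open>0, 1, 2, \<dots>\<close> one after the other yields in the limit a point of \<open>K\<close> with
  the same value of \<open>f\<close> that differs from the starting point in every coordinate, a contradiction.
\<close>

section \<open>Coordinatewise limits and closed sets of large measure\<close>

lemma tendsto_coordinatewise:
  assumes "\<And>i. ((\<lambda>c. f c i) \<longlongrightarrow> l i) F"
  shows "(f \<longlongrightarrow> l) F"
proof -
  have "limitin (product_topology (\<lambda>_. euclidean) UNIV) f l F"
    unfolding limitin_componentwise using assms by simp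
  then show ?thesis
    by (simp add: euclidean_product_topology)
qed

text \<open>Inner regularity with respect to compact sets, which are closed.\<close>

lemma closed_inner_approx:
  fixes P :: "'a::{second_countable_topology, complete_space} measure"
  assumes "finite_measure P" and sets_P: "sets P = sets borel" and A: "A \<in> sets borel" and e: "0 < e"
  obtains C where "closed C" "C \<subseteq> A" "measure P (A - C) < e"
proof -
  interpret finite_measure P by fact
  have "\<exists>C. closed C \<and> C \<subseteq> A \<and> measure P A - e < measure P C"
  \<comment> \<open>In this case \<open>measure P A - e\<close> is negative and
    \<open>ennreal\<close> would truncate it to 0, so the empty set is taken instead.\<close>
  proof (cases "measure P A < e")
    case True
    then show ?thesis by (intro exI[of _ "{}"]) auto
  next
    case False
    have "ennreal (measure P A - e) < emeasure P A"
      using e False by (simp add: emeasure_eq_measure ennreal_less_iff)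
    also have "\<dots> = (SUP C \<in> {C. C \<subseteq> A \<and> compact C}. emeasure P C)"
      by (rule inner_regular[OF sets_P _ A]) simp
    finally obtain C where "C \<subseteq> A" "compact C" "ennreal (measure P A - e) < emeasure P C"
      by (auto simp: less_SUP_iff)
    then show ?thesis
      using False
      by (intro exI[of _ C]) (auto simp: emeasure_eq_measure ennreal_less_iff intro: compact_imp_closed)
  qed
  then obtain C where C: "closed C" "C \<subseteq> A" "measure P A - e < measure P C" by blast
  moreover have "measure P (A - C) = measure P A - measure P C"
    using C A by (intro finite_measure_Diff) (auto simp: sets_P)
  ultimately show thesis by (intro that[of C]) auto
qed

text \<open>A form of Lusin's theorem, giving only the closedness of the fibres that its continuity
  statement would entail.\<close>

lemma closed_fibres_on_large_set:
  fixes P :: "'a::{second_countable_topology, complete_space} measure"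
    and f :: "'a \<Rightarrow> 'b::{second_countable_topology, t2_space}"
  assumes "prob_space P" and sets_P: "sets P = sets borel" and f: "f \<in> borel_measurable borel"
  obtains K where "closed K" "0 < measure P K" "\<And>v. closed {x \<in> K. f x = v}"
proof -
  interpret prob_space P by fact
  have finP: "finite_measure P"
    by (rule finite_measure_axioms)
  obtain \<B> :: "'b set set" where \<B>: "countable \<B>" "topological_basis \<B>"
    using ex_countable_basis by blast
  have "\<B> \<noteq> {}"
    using topological_basisE[OF \<B>(2) open_UNIV UNIV_I] by blast
  define U where "U = from_nat_into \<B>"
  have U_range: "range U = \<B>"
    using \<B>(1) \<open>\<B> \<noteq> {}\<close> by (simp add: U_def)
  \<comment> \<open>Each \<open>k\<close> costs two approximation errors below \<open>e k\<close>;
    the sum of all \<open>2 * e k\<close> is 1/2, which leaves \<open>K\<close> at least half of the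
    mass.\<close>
  define e :: "nat \<Rightarrow> real" where "e k = (1/2) ^ k / 8" for k
  have "open (U k)" for k
    using topological_basis_open[OF \<B>(2)] U_range by blast
  then have A: "f -` U k \<in> sets borel" for k
    using measurable_sets[OF f, of "U k"] by simp
  have "\<exists>C. closed C \<and> C \<subseteq> f -` U k \<and> measure P (f -` U k - C) < e k" for k
    by (rule closed_inner_approx[OF finP sets_P A, of "e k" k]) (auto simp: e_def)
  then obtain C where C: "\<And>k. closed (C k)" "\<And>k. C k \<subseteq> f -` U k"
      "\<And>k. measure P (f -` U k - C k) < e k"
    by metis
  have "\<exists>C. closed C \<and> C \<subseteq> - (f -` U k) \<and> measure P (- (f -` U k) - C) < e k" for k
    by (rule closed_inner_approx[OF finP sets_P borel_comp[OF A], of "e k" k]) (auto simp: e_def)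
  then obtain C' where C': "\<And>k. closed (C' k)" "\<And>k. C' k \<subseteq> - (f -` U k)"
      "\<And>k. measure P (- (f -` U k) - C' k) < e k"
    by metis
  \<comment> \<open>On \<open>K\<close>, whether \<open>f x\<close> lies in \<open>U k\<close> is
    decided by which of the disjoint closed sets \<open>C k\<close> and \<open>C' k\<close> contains
    \<open>x\<close>.\<close>
  define K where "K = (\<Inter>k. C k \<union> C' k)"
  define R where "R k = (f -` U k - C k) \<union> (- (f -` U k) - C' k)" for k
  have closed_K: "closed K"
    using C(1) C'(1) by (auto simp: K_def)
  have R: "R k \<in> sets P" for k
    using A[of k] C(1)[of k] C'(1)[of k] by (auto simp: R_def sets_P intro!: borel_comp)
  have R_le: "measure P (R k) \<le> (1/2) ^ k / 4" for k
  proof -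
    have "measure P (R k) \<le> measure P (f -` U k - C k) + measure P (- (f -` U k) - C' k)"
      unfolding R_def using A[of k] C(1)[of k] C'(1)[of k]
      by (intro measure_Un_le) (auto simp: sets_P intro!: borel_comp)
    also have "\<dots> \<le> (1/2) ^ k / 4"
      using C(3)[of k] C'(3)[of k] by (simp add: e_def)
    finally show ?thesis .
  qed
  have sum4: "(\<lambda>k. (1/2::real) ^ k / 4) sums (2 / 4)"
    using geometric_sums[of "1/2::real"] by (intro sums_divide) simp
  have summable_R: "summable (\<lambda>k. measure P (R k))"
    by (rule summable_comparison_test[OF _ sums_summable[OF sum4]]) (use R_le in auto)
  have "measure P (\<Union>k. R k) \<le> (\<Sum>k. measure P (R k))"
    by (rule finite_measure_subadditive_countably) (use R summable_R in auto)
  also have "\<dots> \<le> (\<Sum>k. (1/2) ^ k / 4)"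
    by (rule suminf_le[OF R_le summable_R sums_summable[OF sum4]])
  also have "\<dots> = 1 / 2"
    using sums_unique[OF sum4] by simp
  finally have R_small: "measure P (\<Union>k. R k) \<le> 1 / 2" .
  have "space P - K \<subseteq> (\<Union>k. R k)"
    by (auto simp: K_def R_def)
  then have "measure P (space P - K) \<le> measure P (\<Union>k. R k)"
    using R by (intro finite_measure_mono) auto
  moreover have "measure P (space P - K) = 1 - measure P K"
    using closed_K by (intro prob_compl) (simp add: sets_P)
  ultimately have "0 < measure P K"
    using R_small by linarith
  moreover have "closed {x \<in> K. f x = v}" for v
  proof -
    \<comment> \<open>A value other than \<open>v\<close> lies in some basic set \<open>U k\<close>
      that misses \<open>v\<close>, and membership in \<open>C' k\<close> excludes this.\<close>
    have "{x \<in> K. f x = v} = K \<inter> (\<Inter>k \<in> {k. v \<notin> U k}. C' k)" (is "_ = ?F")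
    proof (intro equalityI subsetI)
      fix x assume "x \<in> {x \<in> K. f x = v}"
      then show "x \<in> ?F"
        using C(2) by (auto simp: K_def)
    next
      fix x assume x: "x \<in> ?F"
      have "f x = v"
      proof (rule ccontr)
        assume "f x \<noteq> v"
        then obtain V where "open V" "f x \<in> V" "v \<notin> V"
          using t1_space by blast
        then obtain B where "B \<in> \<B>" "f x \<in> B" "B \<subseteq> V"
          using topological_basisE[OF \<B>(2)] by metis
        moreover then obtain k where "B = U k"
          using U_range by blast
        ultimately show False
          using x C'(2)[of k] \<open>v \<notin> V\<close> by auto
      qed
      then show "x \<in> {x \<in> K. f x = v}"
        using x by simp
    qed
    moreover have "closed \<dots>"
      using closed_K C'(1) by (intro closed_Int closed_INT) auto
    ultimately show ?thesis
      by simp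
  qed
  ultimately show thesis
    using that closed_K by blast
qed

section \<open>Fubini's theorem for single coordinates of a product measure\<close>

text \<open>The measure of the section of the exceptional set depends measurably on
  \<open>x\<close>, and \<open>AE\<close> says that it vanishes.\<close>

lemma (in sigma_finite_measure) pred_AE:
  assumes "Measurable.pred (N \<Otimes>\<^sub>M M) (\<lambda>(x, y). P x y)"
  shows "Measurable.pred N (\<lambda>x. AE y in M. P x y)"
proof -
  have [measurable]: "Measurable.pred (N \<Otimes>\<^sub>M M) (\<lambda>p. P (fst p) (snd p))"
    using assms by (simp add: case_prod_beta')
  have "Measurable.pred N (\<lambda>x. emeasure M {y \<in> space M. \<not> P x y} = 0)"
    by measurable
  moreover have "(AE y in M. P x y) \<longleftrightarrow> emeasure M {y \<in> space M. \<not> P x y} = 0"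
    if "x \<in> space N" for x
  proof (rule AE_iff_measurable[OF _ refl])
    have "Measurable.pred M (P x)"
      using measurable_compose[OF measurable_Pair1'[OF that] assms] by simp
    then show "{y \<in> space M. \<not> P x y} \<in> sets M"
      by measurable
  qed
  ultimately show ?thesis
    by (simp cong: measurable_cong)
qed

context sequence_space
begin

text \<open>Resampling one coordinate independently preserves the product measure.\<close>

lemma distr_fun_upd: "distr (M \<Otimes>\<^sub>M S) S (\<lambda>(z, x). x(n := z)) = S"
  using distr_pair_PiM_eq_PiM[of UNIV "\<lambda>_. M" n] by (simp add: M.prob_space_axioms)

lemma measurable_fun_upd_pair [measurable]: "(\<lambda>(z, x). x(n := z)) \<in> M \<Otimes>\<^sub>M S \<rightarrow>\<^sub>M S"
  using measurable_fun_upd[of UNIV UNIV n snd "M \<Otimes>\<^sub>M S" "\<lambda>_. M" fst]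
  by (simp add: case_prod_beta')

text \<open>Invariance under resampling moves the statement to \<open>M \<Otimes>\<^sub>M S\<close>,
  where Fubini splits it; the final exchange puts the resampled coordinate innermost.\<close>

lemma AE_iff_AE_fun_upd:
  assumes [measurable]: "Measurable.pred S Q"
  shows "(AE x in S. Q x) \<longleftrightarrow> (AE x in S. AE z in M. Q (x(n := z)))"
proof -
  interpret pair_sigma_finite M S ..
  have "(AE x in S. Q x) \<longleftrightarrow> (AE x in distr (M \<Otimes>\<^sub>M S) S (\<lambda>(z, x). x(n := z)). Q x)"
    by (simp only: distr_fun_upd)
  also have "\<dots> \<longleftrightarrow> (AE p in M \<Otimes>\<^sub>M S. Q ((\<lambda>(z, x). x(n := z)) p))"
    by (rule AE_distr_iff) measurable
  also have "\<dots> \<longleftrightarrow> (AE z in M. AE x in S. Q (x(n := z)))"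
    using AE_pair_iff[of "\<lambda>z x. Q (x(n := z))"] by (simp add: case_prod_beta')
  also have "\<dots> \<longleftrightarrow> (AE x in S. AE z in M. Q (x(n := z)))"
    by (rule AE_commute) measurable
  finally show ?thesis .
qed

text \<open>Closing a null set off under the sections that it charges makes Fubini's theorem hold
  everywhere outside it, so that it can be applied along a sequence of coordinate changes.\<close>

lemma AE_fun_upd_closed:
  assumes Q: "Measurable.pred S Q" and "AE x in S. Q x"
  obtains Q' where "Measurable.pred S Q'" "AE x in S. Q' x" "\<And>x. Q' x \<Longrightarrow> Q x"
    "\<And>x n. x \<in> space S \<Longrightarrow> Q' x \<Longrightarrow> AE z in M. Q' (x(n := z))"
proof -
  \<comment> \<open>One pass secures only \<open>Q\<close> at the changed points, not the new
    condition itself, hence the iteration.\<close>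
  define G where "G i = ((\<lambda>q x. q x \<and> (\<forall>n. AE z in M. q (x(n := z)))) ^^ i) Q" for i :: nat
  have G_Suc: "G (Suc i) x \<longleftrightarrow> G i x \<and> (\<forall>n. AE z in M. G i (x(n := z)))" for i x
    by (simp add: G_def)
  have meas: "Measurable.pred S (G i)" for i
  proof (induction i)
    case 0
    then show ?case using Q by (simp add: G_def)
  next
    case (Suc i)
    note [measurable] = Suc
    have [measurable]: "Measurable.pred S (\<lambda>x. AE z in M. G i (x(n := z)))" for n
    proof -
      have "Measurable.pred (S \<Otimes>\<^sub>M M) (\<lambda>(x, z). G i (x(n := z)))"
        by measurable
      then show ?thesis
        by (rule M.pred_AE)
    qed
    show ?case
      unfolding G_Suc[abs_def] by measurable
  qed
  have AE_G: "AE x in S. G i x" for i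
  proof (induction i)
    case 0
    then show ?case using assms(2) by (simp add: G_def)
  next
    case (Suc i)
    have "AE x in S. AE z in M. G i (x(n := z))" for n
      using Suc AE_iff_AE_fun_upd[OF meas] by blast
    then have "AE x in S. \<forall>n. AE z in M. G i (x(n := z))"
      by (simp add: AE_all_countable)
    with Suc show ?case
      by (auto simp: G_Suc)
  qed
  show thesis
  proof
    show "Measurable.pred S (\<lambda>x. \<forall>i. G i x)"
      using meas by measurable
    show "AE x in S. \<forall>i. G i x"
      using AE_G by (simp add: AE_all_countable)
    show "Q x" if "\<forall>i. G i x" for x
      using that[rule_format, of 0] by (simp add: G_def)
    \<comment> \<open>\<open>G (Suc i) x\<close> yields \<open>G i\<close> at almost every changed
      point, so the intersection over all \<open>i\<close> is stable.\<close>
    show "AE z in M. \<forall>i. G i (x(n := z))" if "\<forall>i. G i x" for x n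
      unfolding AE_all_countable using that G_Suc by blast
  qed
qed

end


section \<open>Moving every coordinate within one fibre\<close>

text \<open>The measure-theoretic core, separated from \<open>E1\<close>: the reduction enters only
  through the countability of the values of \<open>f\<close> on each line.\<close>

lemma equal_values_on_disjoint_sequences:
  fixes M :: "'a::polish_space measure"
    and f :: "(nat \<Rightarrow> 'a) \<Rightarrow> 'b::{second_countable_topology, t2_space}"
  assumes "prob_space M" and sets_M: "sets M = sets borel"
    and atomless: "\<And>z. emeasure M {z} = 0"
    and f: "f \<in> borel_measurable borel"
    and countable_lines: "\<And>x n. countable (range (\<lambda>z. f (x(n := z))))"
  obtains x y where "\<And>n. x n \<noteq> y n" "f x = f y"
proof -
  interpret M: prob_space M by fact
  interpret sequence_space M ..
  have space_M [simp]: "space M = UNIV"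
    using sets_eq_imp_space_eq[OF sets_M] by simp
  have space_S [simp]: "space S = UNIV"
    by (simp add: space_PiM)
  have sets_S: "sets S = sets borel"
    using sets_PiM_cong[OF refl sets_M] sets_PiM_equal_borel by blast
  have [measurable]: "f \<in> borel_measurable S"
    using f measurable_cong_sets[OF sets_S refl] by blast
  obtain K where K: "closed K" "0 < measure S K" and fibre: "\<And>v. closed {x \<in> K. f x = v}"
    using closed_fibres_on_large_set[OF P.prob_space_axioms sets_S f] by blast
  have [measurable]: "K \<in> sets S"
    using K(1) by (simp add: sets_S)
  \<comment> \<open>The admissible changes must form a non-null set, not just a nonempty one, so
    that null sets can be discarded from it later.\<close>
  define good where "good n x \<longleftrightarrow>
    (x \<in> K \<longrightarrow> \<not> (AE z in M. \<not> (x(n := z) \<in> K \<and> f (x(n := z)) = f x)))" for n x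
  have good_meas [measurable]: "Measurable.pred S (good n)" for n
  proof -
    have "Measurable.pred (S \<Otimes>\<^sub>M M) (\<lambda>(x, z). \<not> (x(n := z) \<in> K \<and> f (x(n := z)) = f x))"
      by measurable
    from M.pred_AE[OF this] show ?thesis
      unfolding good_def[abs_def] by measurable
  qed
  have "AE z in M. good n (x(n := z))" for n x
  proof -
    \<comment> \<open>\<open>V\<close> collects the values whose level set in \<open>K\<close> along
      the line is null. Being countably many, these level sets are avoided by almost every
      \<open>z\<close>, and such a \<open>z\<close> gives a good point.\<close>
    define V where "V = {v \<in> range (\<lambda>z. f (x(n := z))). AE z in M. \<not> (x(n := z) \<in> K \<and> f (x(n := z)) = v)}"
    have "countable V"
      unfolding V_def by (rule countable_subset[OF _ countable_lines[of x n]]) blast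
    then have "AE z in M. \<forall>v\<in>V. \<not> (x(n := z) \<in> K \<and> f (x(n := z)) = v)"
      by (subst AE_ball_countable) (auto simp: V_def)
    then show ?thesis
      by eventually_elim (auto simp: good_def V_def)
  qed
  then have "AE x in S. good n x" for n
    by (subst AE_iff_AE_fun_upd[of _ n]) auto
  then have AE_good: "AE x in S. \<forall>n. good n x"
    by (simp add: AE_all_countable)
  have good_all_meas: "Measurable.pred S (\<lambda>x. \<forall>n. good n x)"
    by measurable
  obtain Q where Q: "AE x in S. Q x" "\<And>x. Q x \<Longrightarrow> \<forall>n. good n x"
      "\<And>x n. x \<in> space S \<Longrightarrow> Q x \<Longrightarrow> AE z in M. Q (x(n := z))"
    by (rule AE_fun_upd_closed[OF good_all_meas AE_good]) blast
  define W where "W = {x \<in> K. Q x}"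
  have "W \<noteq> {}"
  proof
    assume "W = {}"
    then have "AE x in S. x \<notin> K"
      using Q(1) by (auto simp: W_def)
    then have "measure S K = 0"
      using P.prob_eq_0[of K] by simp
    then show False
      using K(2) by simp
  qed
  then obtain a where "a \<in> W" by blast
  \<comment> \<open>From the non-null set provided by \<open>good\<close>, remove the null set where
    \<open>Q\<close> fails and the point \<open>x n\<close>, null since \<open>M\<close> is
    atomless; something remains.\<close>
  have "\<exists>z. z \<noteq> x n \<and> x(n := z) \<in> W \<and> f (x(n := z)) = f x" if "x \<in> W" for x n
  proof (rule ccontr)
    assume none: "\<nexists>z. z \<noteq> x n \<and> x(n := z) \<in> W \<and> f (x(n := z)) = f x"
    have "{x n} \<in> null_sets M"
      using atomless by (auto simp: null_sets_def sets_M)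
    then have "AE z in M. z \<noteq> x n"
      using AE_not_in by fastforce
    moreover have "AE z in M. Q (x(n := z))"
      using that Q(3) by (simp add: W_def)
    ultimately have "AE z in M. \<not> (x(n := z) \<in> K \<and> f (x(n := z)) = f x)"
      by eventually_elim (use none in \<open>auto simp: W_def\<close>)
    then show False
      using that Q(2)[of x] by (simp add: W_def good_def)
  qed
  note step = this
  define s where "s n x = (SOME z. z \<noteq> x n \<and> x(n := z) \<in> W \<and> f (x(n := z)) = f x)" for n x
  have s: "s n x \<noteq> x n \<and> x(n := s n x) \<in> W \<and> f (x(n := s n x)) = f x" if "x \<in> W" for x n
    unfolding s_def by (rule someI_ex[OF step[OF that]])
  define u where "u = rec_nat a (\<lambda>n x. x(n := s n x))"
  have u_simps: "u 0 = a" "\<And>n. u (Suc n) = (u n)(n := s n (u n))"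
    by (simp_all add: u_def)
  have u_W: "u m \<in> W \<and> f (u m) = f a" for m
  proof (induction m)
    case 0
    then show ?case using \<open>a \<in> W\<close> by (simp add: u_simps)
  next
    case (Suc m)
    then show ?case using s[of "u m" m] u_simps(2)[of m] by metis
  qed
  have before: "m \<le> n \<Longrightarrow> u m n = a n" for m n
    by (induction m) (auto simp: u_simps)
  \<comment> \<open>Coordinate \<open>n\<close> is changed only in passing from \<open>u n\<close>
    to \<open>u (Suc n)\<close>, so it is final from index \<open>Suc n\<close> on.\<close>
  define b where "b n = u (Suc n) n" for n
  have after: "Suc n \<le> m \<Longrightarrow> u m n = b n" for m n
    by (induction m rule: dec_induct) (auto simp: u_simps b_def)
  have "u \<longlonglongrightarrow> b"
  proof (rule tendsto_coordinatewise)
    show "(\<lambda>m. u m n) \<longlonglongrightarrow> b n" for n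
      using after by (intro tendsto_eventually eventually_sequentiallyI[of "Suc n"]) auto
  qed
  moreover have "u m \<in> {x \<in> K. f x = f a}" for m
    using u_W[of m] by (simp add: W_def)
  ultimately have "b \<in> {x \<in> K. f x = f a}"
    using closed_sequentially[OF fibre] by blast
  moreover have "a n \<noteq> b n" for n
    using s[of "u n" n] u_W[of n] before[of n n] by (auto simp: b_def u_simps)
  ultimately show thesis
    using that[of a b] by simp
qed

section \<open>The fair coin measure and the application to \<open>E1\<close>\<close>

text \<open>For independent fair coin tosses, fixing the bits up to index \<open>n\<close> has
  probability \<open>(1 / 2) ^ Suc n\<close>, which tends to 0.\<close>

lemma ex_atomless_measure_cantor:
  obtains M :: "(nat \<Rightarrow> bool) measure"
  where "prob_space M" "sets M = sets borel" "\<And>z. emeasure M {z} = 0"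
proof -
  define C :: "bool measure" where "C = uniform_count_measure UNIV"
  have C_single: "measure C {b} = 1 / 2" for b
    by (simp add: C_def measure_uniform_count_measure)
  have sets_C: "sets C = sets borel"
    by (simp add: C_def sets_uniform_count_measure sets_borel_eq_count_space)
  interpret C: prob_space C
    unfolding C_def by (rule prob_space_uniform_count_measure) auto
  interpret sequence_space C ..
  have sets_S: "sets S = sets borel"
    using sets_PiM_cong[OF refl sets_C] sets_PiM_equal_borel by blast
  have "emeasure S {z} = 0" for z
  proof -
    have "(\<lambda>n. \<Prod>i\<le>n. measure C {z i}) \<longlonglongrightarrow> measure S (Pi UNIV (\<lambda>i. {z i}))"
      by (rule measure_PiM_countable) (simp add: sets_C)
    moreover have "Pi UNIV (\<lambda>i. {z i}) = {z}"
      by auto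
    ultimately have "(\<lambda>n. (1 / 2) ^ Suc n) \<longlonglongrightarrow> measure S {z}"
      by (simp add: C_single)
    moreover have "(\<lambda>n. (1 / 2 :: real) ^ Suc n) \<longlonglongrightarrow> 0"
      by (intro LIMSEQ_Suc LIMSEQ_power_zero) simp
    ultimately have "measure S {z} = 0"
      using LIMSEQ_unique by blast
    then show ?thesis
      by (simp add: P.emeasure_eq_measure)
  qed
  then show thesis
    using that[OF P.prob_space_axioms sets_S] by blast
qed

lemma measurable_coordinate:
  "(\<lambda>x :: 'i::countable \<Rightarrow> 'a::second_countable_topology. x i) \<in> borel_measurable borel"
proof -
  have "(\<lambda>x :: 'i \<Rightarrow> 'a. x i) \<in> borel_measurable (Pi\<^sub>M UNIV (\<lambda>_. borel))"
    by measurable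
  then show ?thesis
    using measurable_cong_sets[OF sets_PiM_equal_borel refl] by blast
qed

text \<open>Points differing in every coordinate are \<open>E1\<close>-inequivalent, so their images
  under the reduction are too, while equality under \<open>f\<close> says that all first bits of the
  images agree.\<close>

lemma ex_E1_inequivalent_pair_with_equal_first_bits:
  assumes "borel_reducible UNIV E1 B (Restr E1 B)"
  obtains x y where "x \<in> B" "y \<in> B" "(x, y) \<notin> E1" "\<And>n. x n 0 = y n 0"
proof -
  obtain \<Phi> where \<Phi>: "\<Phi> \<in> restrict_space borel UNIV \<rightarrow>\<^sub>M restrict_space borel B"
    and red: "\<And>a b. (a, b) \<in> E1 \<longleftrightarrow> (\<Phi> a, \<Phi> b) \<in> Restr E1 B"
    using assms unfolding borel_reducible_def by blast
  have \<Phi>_borel: "\<Phi> \<in> borel_measurable borel" and \<Phi>_B: "\<Phi> a \<in> B" for a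
    using \<Phi> by (auto simp: measurable_restrict_space2_iff space_restrict_space)
  define f where "f a = (\<lambda>n. \<Phi> a n 0)" for a
  have f: "f \<in> borel_measurable borel"
    unfolding f_def
    by (intro measurable_coordinatewise_then_product
        measurable_compose[OF measurable_compose[OF \<Phi>_borel measurable_coordinate] measurable_coordinate])
  have countable_lines: "countable (range (\<lambda>z. f (a(n := z))))" for a n
  proof -
    have "(a, a(n := z)) \<in> E1" for z
    proof -
      have "\<forall>m\<ge>Suc n. a m = (a(n := z)) m"
        by simp
      then show ?thesis
        unfolding E1_def by blast
    qed
    then have "(\<Phi> a, \<Phi> (a(n := z))) \<in> E1" for z
      using red by blast
    then have "\<exists>k. \<forall>m\<ge>k. \<Phi> a m = \<Phi> (a(n := z)) m" for z
      unfolding E1_def by blast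
    then have "\<exists>k. \<forall>m\<ge>k. f (a(n := z)) m = f a m" for z
      unfolding f_def by metis
    then have "range (\<lambda>z. f (a(n := z))) \<subseteq> (\<Union>k. {v. \<forall>m\<ge>k. v m = f a m})"
      by auto
    moreover have "countable {v. \<forall>m\<ge>k. v m = f a m}" for k
    proof (rule countable_subset)
      \<comment> \<open>A modification below \<open>k\<close> is coded by the finite list of its
        first \<open>k\<close> bits.\<close>
      show "{v. \<forall>m\<ge>k. v m = f a m} \<subseteq> range (\<lambda>s m. if m < k then s ! m else f a m)"
      proof
        fix v assume "v \<in> {v. \<forall>m\<ge>k. v m = f a m}"
        then have "v = (\<lambda>m. if m < k then map v [0..<k] ! m else f a m)"
          by (auto simp: fun_eq_iff)
        then show "v \<in> range (\<lambda>s m. if m < k then s ! m else f a m)"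
          by (rule range_eqI)
      qed
    qed simp
    ultimately show ?thesis
      by (meson countable_UN countableI_type countable_subset)
  qed
  obtain M :: "(nat \<Rightarrow> bool) measure"
    where "prob_space M" "sets M = sets borel" "\<And>z. emeasure M {z} = 0"
    using ex_atomless_measure_cantor by blast
  from equal_values_on_disjoint_sequences[OF this f countable_lines]
  obtain a b where ab: "\<And>n. a n \<noteq> b n" "f a = f b"
    by blast
  then have "(a, b) \<notin> E1"
    by (auto simp: E1_def)
  then have "(\<Phi> a, \<Phi> b) \<notin> E1"
    using red \<Phi>_B by blast
  then show thesis
    using that[of "\<Phi> a" "\<Phi> b"] \<Phi>_B ab(2) by (auto simp: f_def fun_eq_iff)
qed

section \<open>Openness, density and comeagerness of \<open>D\<close>\<close>

lemma topspace_tuple_topology: "topspace (tuple_topology n) = {..<n} \<rightarrow>\<^sub>E UNIV"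
  by (simp add: tuple_topology_def)

lemma openin_D: "openin (tuple_topology 2) D"
proof -
  let ?T = "tuple_topology 2 :: (nat \<Rightarrow> nat \<Rightarrow> nat \<Rightarrow> bool) topology"
  have coord: "continuous_map ?T euclidean (\<lambda>p. p i n 0)" if "i < 2" for i n
  proof -
    have "continuous_map ?T euclidean (\<lambda>p. p i)"
      using continuous_map_product_projection[of i "{..<2}" "\<lambda>_. euclidean"] that
      by (simp add: tuple_topology_def)
    moreover have "continuous_on UNIV (\<lambda>x :: nat \<Rightarrow> nat \<Rightarrow> bool. x n 0)"
      by (rule continuous_on_product_then_coordinatewise[OF
            continuous_on_product_then_coordinatewise[OF continuous_on_id]])
    ultimately show ?thesis
      using continuous_map_compose[of ?T euclidean "\<lambda>p. p i" euclidean "\<lambda>x. x n 0"]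
      by (simp add: o_def)
  qed
  have "openin ?T {p \<in> topspace ?T. p 0 n 0 \<noteq> p 1 n 0}" for n
  proof -
    have bit: "openin ?T {p \<in> topspace ?T. p i n 0 \<in> {b}}" if "i < 2" for i b
      by (rule openin_continuous_map_preimage[OF coord[OF that]]) (simp add: open_discrete)
    have "openin ?T (\<Union>b. {p \<in> topspace ?T. p 0 n 0 \<in> {b}} \<inter> {p \<in> topspace ?T. p 1 n 0 \<in> {\<not> b}})"
      using bit[of 0] bit[of 1] by (intro openin_Union) auto
    moreover have "(\<Union>b. {p \<in> topspace ?T. p 0 n 0 \<in> {b}} \<inter> {p \<in> topspace ?T. p 1 n 0 \<in> {\<not> b}})
        = {p \<in> topspace ?T. p 0 n 0 \<noteq> p 1 n 0}"
      by auto
    ultimately show ?thesis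
      by simp
  qed
  then have "openin ?T (\<Union>n. {p \<in> topspace ?T. p 0 n 0 \<noteq> p 1 n 0})"
    by (intro openin_Union) blast
  moreover have "D = (\<Union>n. {p \<in> topspace ?T. p 0 n 0 \<noteq> p 1 n 0})"
    by (auto simp: D_def topspace_tuple_topology)
  ultimately show ?thesis
    by simp
qed

text \<open>Membership in \<open>D\<close> needs a single differing first bit, and it can be placed
  in a row so late that a given neighbourhood does not see it.\<close>

lemma dense_D: "tuple_topology 2 closure_of D = topspace (tuple_topology 2)"
proof -
  have "\<exists>q\<in>D. q \<in> T" if "openin (tuple_topology 2) T" and "p \<in> T" for p T
  proof -
    have "\<exists>U. (\<forall>i\<in>{..<2}. openin euclidean (U i)) \<and> p \<in> Pi\<^sub>E {..<2} U \<and> Pi\<^sub>E {..<2} U \<subseteq> T"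
      using that unfolding tuple_topology_def openin_product_topology_alt by blast
    then obtain U where U: "\<forall>i\<in>{..<2}. open (U i)" "p \<in> Pi\<^sub>E {..<2} U" "Pi\<^sub>E {..<2} U \<subseteq> T"
      by (auto simp only: open_openin)
    \<comment> \<open>Only row \<open>k\<close> is altered, so \<open>x k\<close> converges to
      \<open>p 0\<close>; its first bit is set opposite to that of \<open>p 1\<close>, which puts
      the pair in \<open>D\<close> for every \<open>k\<close>.\<close>
    define x where "x k = (p 0)(k := (p 0 k)(0 := \<not> p 1 k 0))" for k
    have "x \<longlonglongrightarrow> p 0"
    proof (rule tendsto_coordinatewise)
      show "(\<lambda>k. x k n) \<longlonglongrightarrow> p 0 n" for n
        by (intro tendsto_eventually eventually_sequentiallyI[of "Suc n"]) (simp add: x_def)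
    qed
    moreover have "open (U 0)" "p 0 \<in> U 0"
      using U by auto
    ultimately obtain k where "x k \<in> U 0"
      using eventually_happens'[OF sequentially_bot] by (metis topological_tendstoD)
    then have "p(0 := x k) \<in> Pi\<^sub>E {..<2} U"
      using U(2) by (auto simp: PiE_def extensional_def Pi_def)
    moreover have "p(0 := x k) \<in> D"
      using U(2) by (auto simp: D_def PiE_def extensional_def x_def intro!: exI[of _ k])
    ultimately show ?thesis
      using U(3) by blast
  qed
  then show ?thesis
    by (auto simp: closure_of_def)
qed

text \<open>The complement is closed with empty interior, so a one-element family witnesses its
  meagerness.\<close>

lemma comeager_in_open_dense:
  assumes "openin T C" "T closure_of C = topspace T"
  shows "comeager_in T C"
proof -
  have "nowhere_dense_in T (topspace T - C)"
    using assms by (simp add: nowhere_dense_in_def closure_of_complement interior_of_openin interior_of_complement)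
  then show ?thesis
    using assms(1) openin_subset unfolding comeager_in_def meager_in_def
    by (intro conjI exI[of _ "{topspace T - C}"]) auto
qed

theorem theorem13p4:
  shows "openin (tuple_topology 2) D
    \<and> tuple_topology 2 closure_of D = topspace (tuple_topology 2)
    \<and> (\<forall>B :: (nat \<Rightarrow> nat \<Rightarrow> bool) set. B \<in> sets borel \<longrightarrow>
         borel_bireducible B (Restr E1 B) UNIV E1 \<longrightarrow> \<not> inequivalent_tuples 2 E1 B \<subseteq> D)
    \<and> \<not> mycielski_property 2 E1"
proof -
  \<comment> \<open>Stated for the reduction into \<open>B\<close> to serve both remaining
    conjuncts, where \<open>borel_bireducible\<close> takes its arguments in opposite
    orders.\<close>
  have not_subset: "\<not> inequivalent_tuples 2 E1 B \<subseteq> D"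
    if red: "borel_reducible UNIV E1 B (Restr E1 B)" for B :: "(nat \<Rightarrow> nat \<Rightarrow> bool) set"
  proof -
    obtain x y where xy: "x \<in> B" "y \<in> B" "(x, y) \<notin> E1" "\<And>n. x n 0 = y n 0"
      using ex_E1_inequivalent_pair_with_equal_first_bits[OF red] by blast
    moreover have "(y, x) \<notin> E1"
      using xy(3) equiv_E1 by (meson equivE symE)
    ultimately have "(\<lambda>i\<in>{..<2}. if i = 0 then x else y) \<in> inequivalent_tuples 2 E1 B"
      by (auto simp: inequivalent_tuples_def less_2_cases_iff)
    moreover have "(\<lambda>i\<in>{..<2}. if i = 0 then x else y) \<notin> D"
      using xy(4) by (simp add: D_def)
    ultimately show ?thesis
      by blast
  qed
  \<comment> \<open>The comeager set that defeats the property is \<open>D\<close> itself.\<close>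
  moreover have "\<not> mycielski_property 2 E1"
    using not_subset comeager_in_open_dense[OF openin_D dense_D]
    unfolding mycielski_property_def borel_bireducible_def by blast
  ultimately show ?thesis
    using openin_D dense_D by (simp add: borel_bireducible_def)
qed

end
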